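(* Let $q$ be a prime power, $d\ge 1$ an integer, $E \subset \mathbb{F}_q^d$, and let $M$ be a positive integer, with $|E| \geq 6q^{d-1}$ and $M \leq 4^{-1}q^{d-1}$. Then $$\#\{y\in \mathbb{F}_q^d : |\pi^y(E)|\leq M\} < 12\,q^{d-1}M|E|^{-1}.$$
   Context: $\mathbb{F}_q$ is the finite field with $q$ elements. For a field $\mathbb{F}$ and a point $y\in\mathbb{F}^d$, the radial projection $\pi^y$ maps each point $x\neq y$ of $\mathbb{F}^d$ to the (affine) line containing $x$ and $y$. For $E\subset\mathbb{F}^d$, $\pi^y(E)=\{\pi^y(x): x\in E\setminus\{y\}\}$; thus $|\pi^y(E)|$ is the number of lines through $y$ that contain at least one point of $E\setminus\{y\}$. *)

theory Defs
  imports "HOL-Analysis.Finite_Cartesian_Product" "HOL-Analysis.Cartesian_Space"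
begin

text \<open>
  The affine line through two points of the coordinate space over an arbitrary field
  (\<open>affine hull\<close> is only available over the reals). For \<open>x = y\<close> it degenerates to
  \<open>{y}\<close>, a case excluded below.
\<close>

definition line_through :: "'a::field ^ 'n \<Rightarrow> 'a ^ 'n \<Rightarrow> ('a ^ 'n) set" where
  "line_through y x = {y + t *s (x - y) | t. True}"

definition radial_proj :: "'a::field ^ 'n \<Rightarrow> ('a ^ 'n) set \<Rightarrow> ('a ^ 'n) set set" where
  "radial_proj y E = line_through y ` (E - {y})"

end

theory Submission
  imports Defs "HOL-Analysis.Convex"
begin

text \<open>
  Write \<open>N = q\<^sup>d\<close> and \<open>Q = N / q\<close>, and let \<open>Y\<close> be the set of exceptional points. A line carries on
  average \<open>k = |E| / Q\<close> points of \<open>E\<close>. From a point \<open>y \<in> Y\<close> the set \<open>E\<close> is seen along at most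
  \<open>M \<le> Q / 4\<close> lines, and these lines carry all of \<open>E\<close>. On average each would be expected to carry
  only \<open>k\<close> points, altogether at most \<open>k M \<le> |E| / 4\<close>. So the total excess of \<open>E\<close> over the
  expectation along the lines seen from \<open>y\<close> is a constant fraction of \<open>|E|\<close>.

  Summing this excess over \<open>y \<in> Y\<close> gives \<open>\<Sum>\<^sub>l (|E \<inter> l| - k) h(l)\<close>, where \<open>h(l)\<close> counts
  the \<open>y \<in> Y \<inter> l\<close> that see \<open>E\<close> along \<open>l\<close>. Cauchy--Schwarz bounds its square by the product of two
  second moments. Since two distinct points determine a line, the events that different points of a
  random line lie in \<open>E\<close> are pairwise almost independent, and so \<open>\<Sum>\<^sub>l (|E \<inter> l| - k)\<^sup>2\<close> is
  at most about \<open>Q |E|\<close>. In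
  \<open>\<Sum>\<^sub>l h(l)\<^sup>2\<close> the diagonal pairs contribute at most \<open>M |Y|\<close> and the pairs of distinct points at
  most \<open>|Y|\<^sup>2\<close>. Up to constants this yields \<open>|Y|\<^sup>2 |E|\<^sup>2 \<le> Q |E| (M |Y| + |Y|\<^sup>2)\<close>, that is
  \<open>|Y| |E| \<le> Q M + Q |Y|\<close>, and because \<open>|E| \<ge> 6 Q\<close> the last term is absorbed on the left.

  Sums over lines are replaced throughout by sums over pairs \<open>(x, v)\<close>, standing for the
  parametrised line \<open>t \<mapsto> x + t v\<close>. Every line arises from the same number \<open>q (q - 1)\<close> of pairs with
  \<open>v \<noteq> 0\<close>. The pairs with \<open>v = 0\<close> are kept: with them, two different parameters \<open>t\<close>, \<open>s\<close> make
  \<open>(x + t v, x + s v)\<close> run exactly once through all pairs of points, and the independence becomes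
  exact (\<open>sum_two_points_on_line\<close>). The analytic core is \<open>flag_discrepancy\<close>; the geometry
  of the projection enters through \<open>card_visible_directions_le\<close> and \<open>sum_visible_line_counts_ge\<close>.
\<close>

section \<open>Second moments of sums along parametrised lines\<close>

lemma sum_shear:
  fixes f :: "'a::{field,finite} ^ 'n \<Rightarrow> 'a ^ 'n \<Rightarrow> real"
  shows "(\<Sum>x\<in>UNIV. \<Sum>v\<in>UNIV. f (x + t *s v) v) = (\<Sum>x\<in>UNIV. \<Sum>v\<in>UNIV. f x v)"
proof -
  have "(\<Sum>x\<in>UNIV. f (x + t *s v) v) = (\<Sum>x\<in>UNIV. f x v)" for v
    by (rule sum.reindex_bij_witness[where i = "\<lambda>x. x - t *s v" and j = "\<lambda>x. x + t *s v"]) auto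
  then show ?thesis
    by (subst (1 2) sum.swap) simp
qed

text \<open>
  The linear map \<open>(x, v) \<mapsto> (x + t v, x + s v)\<close> has determinant a power of \<open>s - t\<close>, so it permutes
  the pairs of points: the values at two different parameters of a random line are independent.
\<close>

lemma sum_two_points_on_line:
  fixes a b :: "'a::{field,finite} ^ 'n \<Rightarrow> real"
  assumes "s \<noteq> t"
  shows "(\<Sum>x\<in>UNIV. \<Sum>v\<in>UNIV. a (x + t *s v) * b (x + s *s v)) = sum a UNIV * sum b UNIV"
proof -
  let ?j = "\<lambda>(x, v :: 'a ^ 'n). (x + t *s v, x + s *s v)"
  have determined: "x = x' \<and> v = v'"
    if t: "x + t *s v = x' + t *s v'" and s: "x + s *s v = x' + s *s v'" for x v x' v' :: "'a ^ 'n"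
  proof -
    have "(t - s) *s v = (t - s) *s v'"
      using arg_cong2[OF t s, of "(-)"] by (simp add: vector_sub_rdistrib)
    then have "v = v'"
      using assms by simp
    then show ?thesis
      using t by simp
  qed
  have "inj ?j"
  proof (rule injI)
    fix p p' assume "?j p = ?j p'"
    then show "p = p'"
      using determined[of "fst p" "snd p" "fst p'" "snd p'"] by (simp add: case_prod_unfold prod_eq_iff)
  qed
  then have "bij_betw ?j UNIV UNIV"
    by (simp add: bij_betw_def finite_UNIV_inj_surj)
  from sum.reindex_bij_betw[OF this, of "\<lambda>(y, z). a y * b z"]
  have "(\<Sum>(x, v)\<in>UNIV. a (x + t *s v) * b (x + s *s v)) = (\<Sum>(y, z)\<in>UNIV. a y * b z)"
    by (simp add: case_prod_unfold)
  then show ?thesis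
    by (simp only: sum_product sum.cartesian_product UNIV_Times_UNIV)
qed

text \<open>
  Expanding the square gives a sum over pairs of parameters. The pairs of equal parameters all
  contribute the same amount by \<open>sum_shear\<close>; the others are left to be evaluated by
  \<open>sum_two_points_on_line\<close>. The function may depend on the direction as well as on the point, since
  the second application counts flags consisting of a point and a direction seen from it.
\<close>

lemma sum_square_line_sums:
  fixes f :: "'a::{field,finite} ^ 'n \<Rightarrow> 'a ^ 'n \<Rightarrow> real"
  shows "(\<Sum>x\<in>UNIV. \<Sum>v\<in>UNIV. (\<Sum>t\<in>UNIV. f (x + t *s v) v)\<^sup>2)
       = real CARD('a) * (\<Sum>x\<in>UNIV. \<Sum>v\<in>UNIV. (f x v)\<^sup>2)
         + (\<Sum>t\<in>UNIV. \<Sum>s\<in>UNIV - {t}. \<Sum>x\<in>UNIV. \<Sum>v\<in>UNIV. f (x + t *s v) v * f (x + s *s v) v)"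
proof -
  let ?c = "\<lambda>t s. \<Sum>x\<in>UNIV. \<Sum>v\<in>UNIV. f (x + t *s v) v * f (x + s *s v) v"
  have "(\<Sum>x\<in>UNIV. \<Sum>v\<in>UNIV. (\<Sum>t\<in>UNIV. f (x + t *s v) v)\<^sup>2)
      = (\<Sum>x\<in>UNIV. \<Sum>v\<in>UNIV. \<Sum>t\<in>UNIV. \<Sum>s\<in>UNIV. f (x + t *s v) v * f (x + s *s v) v)"
    by (simp add: power2_eq_square sum_product)
  also have "\<dots> = (\<Sum>x\<in>UNIV. \<Sum>t\<in>UNIV. \<Sum>s\<in>UNIV. \<Sum>v\<in>UNIV. f (x + t *s v) v * f (x + s *s v) v)"
    by (intro sum.cong refl, subst sum.swap, intro sum.cong refl, rule sum.swap)
  also have "\<dots> = (\<Sum>t\<in>UNIV. \<Sum>s\<in>UNIV. ?c t s)"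
    by (subst sum.swap, intro sum.cong refl, rule sum.swap)
  also have "\<dots> = (\<Sum>t\<in>UNIV. ?c t t + (\<Sum>s\<in>UNIV - {t}. ?c t s))"
    by (intro sum.cong refl sum.remove) auto
  also have "\<dots> = (\<Sum>t\<in>UNIV. ?c t t) + (\<Sum>t\<in>UNIV. \<Sum>s\<in>UNIV - {t}. ?c t s)"
    by (rule sum.distrib)
  also have "(\<Sum>t\<in>UNIV. ?c t t) = (\<Sum>t\<in>(UNIV::'a set). \<Sum>x\<in>UNIV. \<Sum>v\<in>UNIV. (f x v)\<^sup>2)"
    unfolding power2_eq_square
    by (rule sum.cong[OF refl], rule sum_shear[of "\<lambda>x v. f x v * f x v"])
  finally show ?thesis by simp
qed

text \<open>
  Independence removes every off-diagonal term when the mean is zero: the variance of a sum of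
  pairwise independent variables.
\<close>

lemma sum_square_centred_line_sums:
  fixes a :: "'a::{field,finite} ^ 'n \<Rightarrow> real"
  assumes "sum a UNIV = 0"
  shows "(\<Sum>x\<in>UNIV. \<Sum>v\<in>UNIV. (\<Sum>t\<in>UNIV. a (x + t *s v))\<^sup>2)
       = real CARD('a) * real CARD('a ^ 'n) * (\<Sum>x\<in>UNIV. (a x)\<^sup>2)"
proof -
  have "(\<Sum>t\<in>UNIV. \<Sum>s\<in>UNIV - {t}. \<Sum>x\<in>UNIV. \<Sum>v\<in>UNIV. a (x + t *s v) * a (x + s *s v)) = 0"
    using assms by (simp add: sum_two_points_on_line)
  then show ?thesis
    using sum_square_line_sums[of "\<lambda>x v. a x"]
    by (simp add: sum_distrib_left mult.assoc del: CARD_vec)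
qed

text \<open>
  Two distinct parameters give two points of \<open>Y\<close>; forgetting the condition on the direction,
  independence bounds their contribution by \<open>|Y|\<^sup>2\<close>. Only the diagonal retains the condition
  \<open>v \<in> P y\<close>, and this is what lets a bound on the number of directions enter the estimate.
\<close>

lemma sum_square_line_counts_le:
  fixes Y :: "('a::{field,finite} ^ 'n) set"
  shows "(\<Sum>x\<in>UNIV. \<Sum>v\<in>UNIV.
            (\<Sum>t\<in>UNIV. of_bool (x + t *s v \<in> Y \<and> v \<in> P (x + t *s v)))\<^sup>2)
       \<le> real CARD('a) * ((\<Sum>y\<in>Y. real (card (P y))) + (real CARD('a) - 1) * (real (card Y))\<^sup>2)"
proof -
  define f :: "'a ^ 'n \<Rightarrow> 'a ^ 'n \<Rightarrow> real" where "f = (\<lambda>y v. of_bool (y \<in> Y \<and> v \<in> P y))"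
  have sum1: "(\<Sum>v\<in>UNIV. (f y v)\<^sup>2) = of_bool (y \<in> Y) * real (card (P y))" for y
  proof -
    have "(f y v)\<^sup>2 = of_bool (y \<in> Y) * of_bool (v \<in> P y)" for v
      by (simp add: f_def)
    then show ?thesis
      by (simp flip: sum_distrib_left)
  qed
  have diag: "(\<Sum>y\<in>UNIV. \<Sum>v\<in>UNIV. (f y v)\<^sup>2) = (\<Sum>y\<in>Y. real (card (P y)))"
    unfolding sum1 by (simp add: of_bool_def if_distrib[of "\<lambda>z. z * _"] sum.If_cases cong: if_cong)
  have off: "(\<Sum>x\<in>UNIV. \<Sum>v\<in>UNIV. f (x + t *s v) v * f (x + s *s v) v) \<le> (real (card Y))\<^sup>2"
    if "s \<noteq> t" for s t
  proof -
    have "(\<Sum>x\<in>UNIV. \<Sum>v\<in>UNIV. f (x + t *s v) v * f (x + s *s v) v)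
        \<le> (\<Sum>x\<in>UNIV. \<Sum>v\<in>UNIV. of_bool (x + t *s v \<in> Y) * of_bool (x + s *s v \<in> Y))"
      by (intro sum_mono) (auto simp: f_def)
    also have "\<dots> = (real (card Y))\<^sup>2"
      using sum_two_points_on_line[OF that, of "\<lambda>y. of_bool (y \<in> Y)" "\<lambda>y. of_bool (y \<in> Y)"]
      by (simp add: power2_eq_square)
    finally show ?thesis .
  qed
  have "(\<Sum>t\<in>(UNIV::'a set). \<Sum>s\<in>UNIV - {t}. \<Sum>x\<in>UNIV. \<Sum>v\<in>UNIV. f (x + t *s v) v * f (x + s *s v) v)
      \<le> (\<Sum>t\<in>(UNIV::'a set). \<Sum>s\<in>UNIV - {t}. (real (card Y))\<^sup>2)"
    by (intro sum_mono off) auto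
  also have "\<dots> = real CARD('a) * ((real CARD('a) - 1) * (real (card Y))\<^sup>2)"
    by (simp add: card_Diff_singleton of_nat_diff Suc_leI)
  finally show ?thesis
    using sum_square_line_sums[of f] diag by (simp add: f_def algebra_simps)
qed

text \<open>
  The excess of a line is independent of the point from which the line is parametrised. Hence the
  sum over flags \<open>(y, v)\<close> equals, up to a factor \<open>q\<close>, the inner product over all lines of the excess
  with the number of flags on the line, to which Cauchy--Schwarz and the two preceding second moment
  bounds apply.
\<close>

lemma flag_discrepancy:
  fixes E Y :: "('a::{field,finite} ^ 'n) set"
  defines "q \<equiv> real CARD('a)" and "N \<equiv> real CARD('a ^ 'n)"
  shows "(\<Sum>y\<in>Y. \<Sum>v\<in>P y. (\<Sum>t\<in>UNIV. of_bool (y + t *s v \<in> E)) - q * real (card E) / N)\<^sup>2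
       \<le> N * real (card E) * ((\<Sum>y\<in>Y. real (card (P y))) + (q - 1) * (real (card Y))\<^sup>2)"
proof -
  have q: "q > 0" and N: "N > 0"
    by (simp_all add: q_def N_def del: CARD_vec)
  define a where "a = (\<lambda>x. of_bool (x \<in> E) - real (card E) / N)"
  define f :: "'a ^ 'n \<Rightarrow> 'a ^ 'n \<Rightarrow> real" where "f = (\<lambda>y v. of_bool (y \<in> Y \<and> v \<in> P y))"
  define g where "g = (\<lambda>x v. \<Sum>t\<in>UNIV. a (x + t *s v))"
  define h where "h = (\<lambda>x v. \<Sum>t\<in>UNIV. f (x + t *s v) v)"
  let ?S = "\<Sum>y\<in>Y. \<Sum>v\<in>P y. (\<Sum>t\<in>UNIV. of_bool (y + t *s v \<in> E)) - q * real (card E) / N"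
  have g_eq: "g x v = (\<Sum>t\<in>UNIV. of_bool (x + t *s v \<in> E)) - q * real (card E) / N" for x v
    by (simp add: g_def a_def sum_subtractf q_def)
  have a_sum: "sum a UNIV = 0"
    using N by (simp add: a_def sum_subtractf N_def del: CARD_vec)
  have a_sq: "(\<Sum>x\<in>UNIV. (a x)\<^sup>2) \<le> real (card E)"
  proof -
    \<comment> \<open>With \<open>c = |E| / N\<close> and \<open>b\<close> the indicator of \<open>E\<close>, \<open>b\<^sup>2 = b\<close> gives \<open>(b - c)\<^sup>2 = b - c (b - c) - c b\<close>.\<close>
    have "(\<Sum>x\<in>UNIV. (a x)\<^sup>2)
        = (\<Sum>x\<in>UNIV. of_bool (x \<in> E) - real (card E) / N * a x - real (card E) / N * of_bool (x \<in> E))"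
      by (intro sum.cong refl) (auto simp: a_def power2_eq_square algebra_simps)
    also have "\<dots> = real (card E) - real (card E) / N * real (card E)"
      unfolding sum_subtractf sum_distrib_left[symmetric] a_sum by simp
    finally show ?thesis
      using N by simp
  qed
  have g_translate: "g (x + t *s v) v = g x v" for x t v
  proof -
    have "a (x + t *s v + s *s v) = a (x + (t + s) *s v)" for s
      by (simp add: vector_sadd_rdistrib add.assoc)
    then show ?thesis
      unfolding g_def
      by (intro sum.reindex_bij_witness[where i = "\<lambda>s. s - t" and j = "\<lambda>s. t + s"]) auto
  qed
  have S_eq: "?S = (\<Sum>x\<in>UNIV. \<Sum>v\<in>UNIV. g x v * f x v)"
  proof -
    have "(\<Sum>v\<in>UNIV. g y v * f y v) = (if y \<in> Y then \<Sum>v\<in>P y. g y v else 0)" for y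
      by (auto simp: f_def of_bool_def if_distrib[of "\<lambda>z. _ * z"] sum.If_cases cong: if_cong)
    then show ?thesis
      unfolding g_eq[symmetric] by (simp add: sum.If_cases)
  qed
  have "(\<Sum>x\<in>UNIV. \<Sum>v\<in>UNIV. g x v * h x v)
      = (\<Sum>x\<in>UNIV. \<Sum>v\<in>UNIV. \<Sum>t\<in>UNIV. g (x + t *s v) v * f (x + t *s v) v)"
    by (simp add: h_def sum_distrib_left g_translate)
  also have "\<dots> = (\<Sum>t\<in>UNIV. \<Sum>x\<in>UNIV. \<Sum>v\<in>UNIV. g (x + t *s v) v * f (x + t *s v) v)"
  proof -
    have "(\<Sum>x\<in>UNIV. \<Sum>v\<in>UNIV. \<Sum>t\<in>UNIV. g (x + t *s v) v * f (x + t *s v) v)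
        = (\<Sum>x\<in>UNIV. \<Sum>t\<in>UNIV. \<Sum>v\<in>UNIV. g (x + t *s v) v * f (x + t *s v) v)"
      by (rule sum.cong[OF refl], rule sum.swap)
    also have "\<dots> = (\<Sum>t\<in>UNIV. \<Sum>x\<in>UNIV. \<Sum>v\<in>UNIV. g (x + t *s v) v * f (x + t *s v) v)"
      by (rule sum.swap)
    finally show ?thesis .
  qed
  also have "\<dots> = (\<Sum>t\<in>(UNIV::'a set). ?S)"
    unfolding S_eq by (rule sum.cong[OF refl], rule sum_shear[of "\<lambda>x v. g x v * f x v"])
  finally have gh: "(\<Sum>x\<in>UNIV. \<Sum>v\<in>UNIV. g x v * h x v) = q * ?S"
    by (simp add: q_def)
  have "(q * ?S)\<^sup>2 \<le> (\<Sum>x\<in>UNIV. \<Sum>v\<in>UNIV. (g x v)\<^sup>2) * (\<Sum>x\<in>UNIV. \<Sum>v\<in>UNIV. (h x v)\<^sup>2)"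
    using Cauchy_Schwarz_ineq_sum[of "\<lambda>(x, v). g x v" "\<lambda>(x, v). h x v" "UNIV \<times> UNIV"]
    unfolding gh[symmetric] by (simp add: sum.cartesian_product case_prod_unfold)
  also have "\<dots> \<le> (q * N * real (card E))
      * (q * ((\<Sum>y\<in>Y. real (card (P y))) + (q - 1) * (real (card Y))\<^sup>2))"
  proof (rule mult_mono)
    show "(\<Sum>x\<in>UNIV. \<Sum>v\<in>UNIV. (g x v)\<^sup>2) \<le> q * N * real (card E)"
      using a_sq q N unfolding g_def sum_square_centred_line_sums[OF a_sum] q_def N_def
      by (intro mult_left_mono) auto
    show "(\<Sum>x\<in>UNIV. \<Sum>v\<in>UNIV. (h x v)\<^sup>2)
        \<le> q * ((\<Sum>y\<in>Y. real (card (P y))) + (q - 1) * (real (card Y))\<^sup>2)"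
      unfolding h_def f_def q_def by (rule sum_square_line_counts_le)
    show "0 \<le> q * N * real (card E)"
      using q N by simp
  qed (intro sum_nonneg zero_le_power2)
  also have "\<dots> = q\<^sup>2 * (N * real (card E) * ((\<Sum>y\<in>Y. real (card (P y))) + (q - 1) * (real (card Y))\<^sup>2))"
    by (simp add: power2_eq_square)
  finally show ?thesis
    using q by (simp add: power_mult_distrib)
qed

section \<open>Directions in which a point sees a set\<close>

definition visible_directions :: "'a::field ^ 'n \<Rightarrow> ('a ^ 'n) set \<Rightarrow> ('a ^ 'n) set" where
  "visible_directions y E = {v. v \<noteq> 0 \<and> (\<exists>l\<in>radial_proj y E. y + v \<in> l)}"

text \<open>Each line through \<open>y\<close> has exactly \<open>q - 1\<close> non-zero direction vectors.\<close>

lemma card_visible_directions_le: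
  fixes E :: "('a::{field,finite} ^ 'n) set"
  shows "card (visible_directions y E) \<le> card (radial_proj y E) * (CARD('a) - 1)"
proof -
  have "card {v. v \<noteq> 0 \<and> y + v \<in> l} \<le> CARD('a) - 1" if l: "l \<in> radial_proj y E" for l
  proof -
    obtain x where x: "l = line_through y x"
      using l by (auto simp: radial_proj_def)
    have "{v. v \<noteq> 0 \<and> y + v \<in> l} \<subseteq> (\<lambda>t. t *s (x - y)) ` (UNIV - {0})"
      by (auto simp: x line_through_def)
    then have "card {v. v \<noteq> 0 \<and> y + v \<in> l} \<le> card (UNIV - {0::'a})"
      by (rule surj_card_le[rotated]) simp
    then show ?thesis
      by (simp add: card_Diff_singleton)
  qed
  then have "(\<Sum>l\<in>radial_proj y E. card {v. v \<noteq> 0 \<and> y + v \<in> l}) \<le> card (radial_proj y E) * (CARD('a) - 1)"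
    using sum_bounded_above[of "radial_proj y E" "\<lambda>l. card {v. v \<noteq> 0 \<and> y + v \<in> l}" "CARD('a) - 1"]
    by simp
  moreover have "visible_directions y E = (\<Union>l\<in>radial_proj y E. {v. v \<noteq> 0 \<and> y + v \<in> l})"
    by (auto simp: visible_directions_def)
  ultimately show ?thesis
    using card_UN_le[of "radial_proj y E" "\<lambda>l. {v. v \<noteq> 0 \<and> y + v \<in> l}"] by simp
qed

text \<open>
  Each point of \<open>E\<close> other than \<open>y\<close> equals \<open>y + t v\<close> for exactly one direction vector \<open>v\<close> once
  \<open>t \<noteq> 0\<close> is fixed, and this \<open>v\<close> is visible. The subtracted \<open>1\<close> accounts for \<open>y\<close> itself,
  which may belong to \<open>E\<close>.
\<close>

lemma sum_visible_line_counts_ge: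
  fixes E :: "('a::{field,finite} ^ 'n) set"
  shows "(real CARD('a) - 1) * (real (card E) - 1)
       \<le> (\<Sum>v\<in>visible_directions y E. \<Sum>t\<in>UNIV. of_bool (y + t *s v \<in> E))"
proof -
  have "real (card E) - 1 \<le> (\<Sum>v\<in>visible_directions y E. of_bool (y + t *s v \<in> E))"
    if "t \<noteq> 0" for t
  proof -
    have "(\<lambda>e. inverse t *s (e - y)) ` (E - {y}) \<subseteq> {v \<in> visible_directions y E. y + t *s v \<in> E}"
    proof (clarsimp simp: that)
      fix e assume "e \<in> E" "e \<noteq> y"
      then show "inverse t *s (e - y) \<in> visible_directions y E"
        using that by (auto simp: visible_directions_def radial_proj_def line_through_def)
    qed
    moreover have "inj_on (\<lambda>e. inverse t *s (e - y)) (E - {y})"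
      using that by (auto intro!: inj_onI)
    ultimately have "card (E - {y}) \<le> card {v \<in> visible_directions y E. y + t *s v \<in> E}"
      using card_inj_on_le[of "\<lambda>e. inverse t *s (e - y)" "E - {y}"
          "{v \<in> visible_directions y E. y + t *s v \<in> E}"] by simp
    moreover have "card E - 1 \<le> card (E - {y})"
      by (cases "y \<in> E") auto
    moreover have "(\<Sum>v\<in>visible_directions y E. of_bool (y + t *s v \<in> E))
        = real (card {v \<in> visible_directions y E. y + t *s v \<in> E})"
      by (simp add: Int_def)
    ultimately show ?thesis
      by linarith
  qed
  then have "(\<Sum>t\<in>UNIV - {0::'a}. real (card E) - 1)
      \<le> (\<Sum>t\<in>UNIV - {0}. \<Sum>v\<in>visible_directions y E. of_bool (y + t *s v \<in> E))"
    by (intro sum_mono) auto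
  also have "\<dots> \<le> (\<Sum>t\<in>UNIV. \<Sum>v\<in>visible_directions y E. of_bool (y + t *s v \<in> E))"
    by (intro sum_mono2) (auto intro!: sum_nonneg)
  also have "\<dots> = (\<Sum>v\<in>visible_directions y E. \<Sum>t\<in>UNIV. of_bool (y + t *s v \<in> E))"
    by (rule sum.swap)
  finally show ?thesis
    by (simp add: card_Diff_singleton of_nat_diff Suc_leI)
qed

section \<open>Points with a small radial projection\<close>

theorem theorem1p1:
  fixes E :: "('a::{field,finite} ^ 'n) set"
    and q d M :: nat
  assumes "CARD('a) = q"
    and "CARD('n) = d"
    and "M > 0"
    and "real (card E) \<ge> 6 * real q ^ (d - 1)"
    and "real M \<le> (1/4) * real q ^ (d - 1)"
  shows "real (card {y :: 'a ^ 'n. card (radial_proj y E) \<le> M})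
           < 12 * real q ^ (d - 1) * real M / real (card E)"
proof -
  define Y where "Y = {y :: 'a ^ 'n. card (radial_proj y E) \<le> M}"
  define Q where "Q = real q ^ (d - 1)"
  define e where "e = real (card E)"
  define m where "m = real (card Y)"
  define k where "k = e / Q"
  have M: "real M \<ge> 1"
    using assms(3) by simp
  have Q: "Q \<ge> 4" and MQ: "4 * real M \<le> Q" and eQ: "e \<ge> 6 * Q"
    using assms(4,5) M by (simp_all add: Q_def e_def)
  have d: "d > 0"
    using assms(2) zero_less_card_finite by metis
  then have N: "real CARD('a ^ 'n) = real q * Q"
    using assms(1,2) by (cases d) (auto simp: Q_def)
  \<comment> \<open>A set of \<open>6 Q\<close> points only fits into the space if \<open>q \<ge> 6\<close>; this makes \<open>q / (q - 1)\<close> at most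
    \<open>6/5\<close> in the final computation.\<close>
  have "e \<le> real q * Q"
    unfolding e_def N[symmetric] by (simp add: card_mono del: CARD_vec)
  then have "6 * Q \<le> real q * Q"
    using eQ by linarith
  then have q: "real q \<ge> 6"
    using Q by simp
  have mean: "real q * e / (real q * Q) = k"
    using q by (simp add: k_def)
  have k: "k \<ge> 0" "k * real M \<le> e / 4"
    using MQ Q eQ by (simp_all add: k_def field_simps)
  have cardP: "real (card (visible_directions y E)) \<le> (real q - 1) * real M" if "y \<in> Y" for y
  proof -
    have "card (visible_directions y E) \<le> M * (q - 1)"
      using card_visible_directions_le[of y E] that assms(1)
      by (metis Y_def mem_Collect_eq mult_le_mono1 order_trans)
    then have "real (card (visible_directions y E)) \<le> real (M * (q - 1))"
      by (rule of_nat_mono)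
    then show ?thesis
      using q by (simp add: of_nat_diff mult.commute)
  qed
  define S where "S = (\<Sum>y\<in>Y. \<Sum>v\<in>visible_directions y E. (\<Sum>t\<in>UNIV. of_bool (y + t *s v \<in> E)) - k)"
  have "(real q - 1) * (2 / 3 * e) \<le>
      (\<Sum>v\<in>visible_directions y E. (\<Sum>t\<in>UNIV. of_bool (y + t *s v \<in> E)) - k)" if "y \<in> Y" for y
  proof -
    have "k * real (card (visible_directions y E)) \<le> (real q - 1) * (e / 4)"
    proof -
      have "k * real (card (visible_directions y E)) \<le> k * ((real q - 1) * real M)"
        using cardP[OF that] k(1) by (rule mult_left_mono)
      also have "\<dots> = (real q - 1) * (k * real M)"
        by simp
      also have "\<dots> \<le> (real q - 1) * (e / 4)"
        using k(2) q by (intro mult_left_mono) auto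
      finally show ?thesis .
    qed
    \<comment> \<open>Here \<open>|E| \<ge> 6 Q \<ge> 24\<close>, so the excess \<open>|E| - 1 - |E| / 4\<close> is at least \<open>2/3 |E|\<close>.\<close>
    moreover have "(real q - 1) * (2 / 3 * e) \<le> (real q - 1) * (e - 1) - (real q - 1) * (e / 4)"
      unfolding right_diff_distrib[symmetric] using q eQ Q by (intro mult_left_mono) auto
    ultimately show ?thesis
      using sum_visible_line_counts_ge[of E y] assms(1)
      by (simp add: sum_subtractf e_def mult.commute)
  qed
  then have "(\<Sum>y\<in>Y. (real q - 1) * (2 / 3 * e)) \<le> S"
    unfolding S_def by (rule sum_mono)
  then have "m * ((real q - 1) * (2 / 3 * e)) \<le> S"
    by (simp add: m_def)
  then have "(m * ((real q - 1) * (2 / 3 * e)))\<^sup>2 \<le> S\<^sup>2"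
    using q by (intro power_mono) (auto simp: m_def e_def)
  also have "S\<^sup>2 \<le> (real q * Q) * e * ((\<Sum>y\<in>Y. real (card (visible_directions y E))) + (real q - 1) * m\<^sup>2)"
    using flag_discrepancy[where E = E and Y = Y and P = "\<lambda>y. visible_directions y E"]
    unfolding N assms(1) S_def m_def e_def[symmetric] mean by simp
  also have "\<dots> \<le> (real q * Q) * e * (m * ((real q - 1) * real M) + (real q - 1) * m\<^sup>2)"
    using sum_mono[of Y, OF cardP] Q by (intro mult_left_mono add_right_mono) (auto simp: m_def e_def)
  finally have main: "(m * ((real q - 1) * (2 / 3 * e)))\<^sup>2
      \<le> (real q * Q) * e * (m * ((real q - 1) * real M) + (real q - 1) * m\<^sup>2)" .
  have e: "e > 0"
    using eQ Q by linarith
  have "m * e < 12 * Q * real M"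
  proof (cases "m = 0")
    case True
    then show ?thesis
      using Q M by simp
  next
    case False
    then have m: "m > 0"
      unfolding m_def by linarith
    have "((real q - 1) * m * e) * (4 / 9 * ((real q - 1) * (m * e)))
        \<le> ((real q - 1) * m * e) * (real q * (Q * (real M + m)))"
      using main by (simp add: power2_eq_square algebra_simps)
    then have "4 / 9 * ((real q - 1) * (m * e)) \<le> real q * (Q * (real M + m))"
      by (rule mult_left_le_imp_le) (use q m e in simp)
    moreover have "5 / 6 * real q * (m * e) \<le> (real q - 1) * (m * e)"
      using q m e by (intro mult_right_mono) auto
    ultimately have "real q * (10 / 27 * (m * e)) \<le> real q * (Q * (real M + m))"
      by linarith
    then have "10 / 27 * (m * e) \<le> Q * (real M + m)"
      by (rule mult_left_le_imp_le) (use q in simp)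
    \<comment> \<open>Absorbing \<open>Q m \<le> m e / 6\<close> leaves the coefficient \<open>10/27 - 1/6 = 11/54 > 1/12\<close>.\<close>
    moreover have "6 * (Q * m) \<le> m * e"
      using eQ m by (simp add: mult.commute)
    moreover have "Q * real M > 0"
      using Q M by simp
    ultimately show ?thesis
      by (simp add: distrib_left)
  qed
  then show ?thesis
    using e by (simp add: Y_def Q_def e_def m_def pos_less_divide_eq)
qed

end
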